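(* Let $A\in\mathbb{R}^{n\times n}$ be of full rank and let $b\in\mathbb{R}^n$ be nonzero. Consider the system $\dot u(t)=Au(t)$ with scalar observable $y(t)=b^\top u(t)$, and let $r$ be the stabilization index of the Krylov spaces $\mathcal V_k=\mathrm{range}[b,A^\top b,\dots,(A^\top)^kb]\subseteq\mathbb{R}^n$, $k\ge0$. Then for almost all choices of distinct delays $0\le\tau_1<\cdots<\tau_{r+1}$ there exist unique coefficients $w_1,\dots,w_{r+1}\in\mathbb{R}$ such that every observable trajectory $y$ satisfies $$\dot y(t)=\sum_{k=1}^{r+1}w_k\,y(t-\tau_k)\qquad\text{for all } t\in\mathbb{R}.$$
   Context: An observable trajectory is a function $y(t)=b^\top u(t)$, $t\in\mathbb{R}$, where $u$ is a solution of $\dot u=Au$. With the convention $\dim\mathcal V_{-1}=0$, the stabilization index $r\ge0$ is the index with $\dim\mathcal V_{r-1}<\dim\mathcal V_r=\dim\mathcal V_{r+1}\le n$; it satisfies $r\le n-1$. "Almost all" is with respect to Lebesgue measure on $\mathbb{R}^{r+1}$ restricted to the set of $(\tau_1,\dots,\tau_{r+1})$ with $0\le\tau_1<\cdots<\tau_{r+1}$. *)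

theory Defs
  imports "HOL-Analysis.Analysis"
begin

definition krylov_space :: "real^'n^'n \<Rightarrow> real^'n \<Rightarrow> nat \<Rightarrow> (real^'n) set" where
  "krylov_space A b k = span ((\<lambda>j. (((*v) (transpose A)) ^^ j) b) ` {..k})"

text \<open>The conditional implements the convention that the space of index \<open>-1\<close> has dimension 0.\<close>

definition is_stabilization_index :: "real^'n^'n \<Rightarrow> real^'n \<Rightarrow> nat \<Rightarrow> bool" where
  "is_stabilization_index A b r \<longleftrightarrow>
     (if r = 0 then 0 else dim (krylov_space A b (r - 1))) < dim (krylov_space A b r) \<and>
     dim (krylov_space A b r) = dim (krylov_space A b (r + 1)) \<and>
     dim (krylov_space A b (r + 1)) \<le> CARD('n)"

text \<open>Well defined for \<open>b \<noteq> 0\<close>, see \<open>ex1_stabilization_index\<close> below.\<close>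

definition stabilization_index :: "real^'n^'n \<Rightarrow> real^'n \<Rightarrow> nat" where
  "stabilization_index A b = (THE r. is_stabilization_index A b r)"

definition observable_trajectory :: "real^'n^'n \<Rightarrow> real^'n \<Rightarrow> (real \<Rightarrow> real) \<Rightarrow> bool" where
  "observable_trajectory A b y \<longleftrightarrow>
     (\<exists>u :: real \<Rightarrow> real^'n. (\<forall>t. (u has_vector_derivative A *v u t) (at t)) \<and> (\<forall>t. y t = b \<bullet> u t))"

text \<open>
  A delay vector in \<open>\<real>\<^sup>m\<close> is an extensional function on \<open>{1..m}\<close>. The product of Borel--Lebesgue
  measures suffices for ``almost all'': its null sets are cofinal in those of its completion, so both
  measures have the same almost-everywhere quantifier.
\<close>

abbreviation delay_measure :: "nat \<Rightarrow> (nat \<Rightarrow> real) measure" where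
  "delay_measure m \<equiv> Pi\<^sub>M {1..m} (\<lambda>_. lborel)"

definition ordered_delays :: "nat \<Rightarrow> (nat \<Rightarrow> real) set" where
  "ordered_delays m = {\<tau>. (\<forall>i\<in>{1..m}. 0 \<le> \<tau> i) \<and> strict_mono_on {1..m} \<tau>}"

lemma krylov_space_mono: "i \<le> j \<Longrightarrow> krylov_space A b i \<subseteq> krylov_space A b j"
  unfolding krylov_space_def by (intro span_mono image_mono) auto

lemma krylov_space_Suc:
  "krylov_space A b (Suc k) = span (insert b ((*v) (transpose A) ` krylov_space A b k))"
proof -
  let ?f = "\<lambda>j. (((*v) (transpose A)) ^^ j) b"
  have "?f ` {..Suc k} = insert b ((*v) (transpose A) ` (?f ` {..k}))"
    unfolding atMost_Suc_eq_insert_0 by (simp add: image_image)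
  moreover have "(*v) (transpose A) ` span (?f ` {..k}) = span ((*v) (transpose A) ` (?f ` {..k}))"
    by (rule span_linear_image[OF matrix_vector_mul_linear, symmetric])
  ultimately show ?thesis
    unfolding krylov_space_def
    by (simp only: span_insert span_span)
qed

lemma krylov_space_stable:
  assumes "dim (krylov_space A b r) = dim (krylov_space A b (Suc r))" and "r \<le> k"
  shows "krylov_space A b k = krylov_space A b r"
  using \<open>r \<le> k\<close>
proof (induction k rule: dec_induct)
  case (step k)
  have "krylov_space A b (Suc r) = krylov_space A b r"
    using subspace_dim_equal[of "krylov_space A b r" "krylov_space A b (Suc r)"] assms(1)
      krylov_space_mono[of r "Suc r" A b]
    by (simp add: krylov_space_def)
  then show ?case
    using step.IH krylov_space_Suc by metis
qed simp

lemma dim_krylov_space_0: "b \<noteq> 0 \<Longrightarrow> 0 < dim (krylov_space A b 0)"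
  by (auto simp: krylov_space_def dim_span dim_eq_0 intro: gr0I)

lemma ex1_stabilization_index:
  fixes A :: "real^'n^'n"
  assumes "b \<noteq> 0"
  shows "\<exists>!r. is_stabilization_index A b r"
proof (rule ex_ex1I)
  let ?d = "\<lambda>k. dim (krylov_space A b k)"
  have le: "?d k \<le> CARD('n)" for k
    using dim_subset_UNIV[of "krylov_space A b k"] by simp
  have mono: "?d i \<le> ?d j" if "i \<le> j" for i j
    by (intro dim_subset krylov_space_mono that)
  have "\<exists>r. ?d r = ?d (Suc r)"
  proof (rule ccontr)
    assume "\<not> ?thesis"
    then have "strict_mono ?d"
      using mono[of _ "Suc _"] by (intro strict_monoI_Suc) (metis le_SucI le_refl order_le_less)
    then show False
      using strict_mono_imp_increasing[of ?d "Suc CARD('n)"] le[of "Suc CARD('n)"] by simp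
  qed
  define r where "r = (LEAST r. ?d r = ?d (Suc r))"
  have eq: "?d r = ?d (Suc r)"
    unfolding r_def by (rule LeastI_ex) fact
  have "(if r = 0 then 0 else ?d (r - 1)) < ?d r"
  proof (cases r)
    case 0
    then show ?thesis using dim_krylov_space_0[OF assms] by simp
  next
    case (Suc s)
    then have "?d s \<noteq> ?d (Suc s)"
      using not_less_Least[of s "\<lambda>r. ?d r = ?d (Suc r)"] by (simp add: r_def)
    then show ?thesis using Suc mono[of s "Suc s"] by simp
  qed
  then have "is_stabilization_index A b r"
    using eq le by (simp only: is_stabilization_index_def Suc_eq_plus1)
  then show "\<exists>r. is_stabilization_index A b r" ..
next
  have "\<not> r < s" if "is_stabilization_index A b r" "is_stabilization_index A b s" for r s
  proof
    assume "r < s"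
    then show False
      using that krylov_space_stable[of A b r s] krylov_space_stable[of A b r "s - 1"]
      by (auto simp: is_stabilization_index_def)
  qed
  then show "r = s" if "is_stabilization_index A b r" "is_stabilization_index A b s" for r s
    using that by (meson linorder_less_linear)
qed

end

theory Submission
  imports Defs "HOL-Complex_Analysis.Conformal_Mappings"
begin

text \<open>
  Let \<open>g(t) = exp(t A\<^sup>T) b\<close>. Along a solution \<open>u\<close> of \<open>u' = A u\<close> the number
  \<open>g(t - s) \<bullet> u(s)\<close> does not depend on \<open>s\<close>, because the two contributions to its derivative
  cancel; at \<open>s = t\<close> it is \<open>b \<bullet> u(t) = y(t)\<close>. Hence \<open>y(t - \<tau>) = g(-\<tau>) \<bullet> u(t)\<close> and
  \<open>y'(t) = A\<^sup>T b \<bullet> u(t)\<close>. Since \<open>u(t)\<close> can be any vector, coefficients \<open>w\<close> satisfy the delay equation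
  for all trajectories exactly when \<open>A\<^sup>T b\<close> is the combination of the vectors \<open>g(-\<tau>\<^sub>k)\<close> with these
  coefficients (\<open>delay_equation_iff\<close>). The curve \<open>g\<close> and the vector \<open>A\<^sup>T b\<close> lie in the stable Krylov space
  \<open>V\<close>, of dimension \<open>r + 1\<close>. So \<open>w\<close> exists uniquely as soon as the \<open>r + 1\<close> vectors \<open>g(-\<tau>\<^sub>k)\<close> are
  linearly independent, and it remains to see that this holds for almost every \<open>\<tau>\<close>.

  Choose the delays one after another. The vectors chosen so far span a space \<open>W\<close> of dimension less than
  \<open>r + 1\<close>, so some nonzero \<open>a\<close> in \<open>V\<close> is orthogonal to \<open>W \<inter> V\<close>. The function
  \<open>t \<mapsto> a \<bullet> g(t)\<close> extends to an entire function. Its Taylor coefficients are, up to factorials,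
  the products \<open>a \<bullet> (A\<^sup>T)\<^sup>k b\<close>, and these do not all vanish, as \<open>a\<close> is in the span of the
  vectors \<open>(A\<^sup>T)\<^sup>k b\<close>. So it has only countably many zeros: the next delay must avoid a null set
  (\<open>countable_observability_curve_in_subspace\<close>). Fubini turns this into a statement about the
  whole delay vector (\<open>AE_samples_independent\<close>); the measurability it requires comes from the
  Gram--Schmidt process, whose vectors are Borel functions of the delays and which produces the zero
  vector exactly at a linearly dependent position.
\<close>

section \<open>The exponential flow of a linear map\<close>

text \<open>
  This is \<open>exp(t L) x\<close>. The series is formed in the vector space itself, so that no normed algebra
  of operators is involved and its components are ordinary power series in \<open>t\<close>.
\<close>

definition linear_flow :: "('a::euclidean_space \<Rightarrow> 'a) \<Rightarrow> 'a \<Rightarrow> real \<Rightarrow> 'a" where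
  "linear_flow L x t = (\<Sum>n. (t ^ n / fact n) *\<^sub>R (L ^^ n) x)"

lemma norm_funpow_linear_le:
  fixes L :: "'a::euclidean_space \<Rightarrow> 'a"
  assumes "linear L"
  shows "norm ((L ^^ n) x) \<le> onorm L ^ n * norm x"
proof (induction n)
  case (Suc n)
  have bl: "bounded_linear L" using assms by (simp add: linear_conv_bounded_linear)
  have "norm (L ((L ^^ n) x)) \<le> onorm L * norm ((L ^^ n) x)"
    by (rule onorm[OF bl])
  also have "\<dots> \<le> onorm L * (onorm L ^ n * norm x)"
    by (intro mult_left_mono Suc onorm_pos_le bl)
  finally show ?case by simp
qed simp

lemma summable_linear_flow:
  fixes L :: "'a::euclidean_space \<Rightarrow> 'a"
  assumes "linear L"
  shows "summable (\<lambda>n. (t ^ n / fact n) *\<^sub>R (L ^^ n) x)"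
proof (rule summable_comparison_test')
  show "summable (\<lambda>n. inverse (fact n) * (\<bar>t\<bar> * onorm L) ^ n * norm x)"
    by (intro summable_mult2 summable_exp)
  show "norm ((t ^ n / fact n) *\<^sub>R (L ^^ n) x) \<le> inverse (fact n) * (\<bar>t\<bar> * onorm L) ^ n * norm x"
    for n
    using mult_left_mono[OF norm_funpow_linear_le[OF assms, of n x], of "\<bar>t\<bar> ^ n / fact n"]
    by (simp add: power_abs power_mult_distrib field_simps)
qed

lemma sums_inner_linear_flow:
  fixes L :: "'a::euclidean_space \<Rightarrow> 'a"
  assumes "linear L"
  shows "(\<lambda>n. (a \<bullet> (L ^^ n) x / fact n) * t ^ n) sums (a \<bullet> linear_flow L x t)"
  using bounded_linear.sums[OF bounded_linear_inner_right summable_sums[OF summable_linear_flow[OF assms, of t x]], of a]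
  by (simp add: linear_flow_def mult.commute)

lemma linear_flow_0:
  fixes L :: "'a::euclidean_space \<Rightarrow> 'a"
  shows "linear_flow L x 0 = x"
proof -
  have "(\<lambda>n. (0 ^ n / fact n) *\<^sub>R (L ^^ n) x) = (\<lambda>n. if n = 0 then (L ^^ n) x else 0)"
    by (auto simp: fun_eq_iff)
  then show ?thesis
    unfolding linear_flow_def using sums_unique[OF sums_single[of 0 "\<lambda>n. (L ^^ n) x"]] by simp
qed

lemma linear_flow_commute:
  fixes L :: "'a::euclidean_space \<Rightarrow> 'a"
  assumes "linear L"
  shows "linear_flow L (L x) t = L (linear_flow L x t)"
proof -
  have "bounded_linear L" using assms by (simp add: linear_conv_bounded_linear)
  from bounded_linear.suminf[OF this summable_linear_flow[OF assms, of t x]]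
  show ?thesis
    by (simp add: linear_flow_def linear_scale[OF assms] funpow_swap1)
qed

lemma inner_linear_flow_has_derivative:
  fixes L :: "'a::euclidean_space \<Rightarrow> 'a"
  assumes "linear L"
  shows "((\<lambda>t. a \<bullet> linear_flow L x t) has_real_derivative a \<bullet> L (linear_flow L x t)) (at t)"
proof -
  let ?c = "\<lambda>x n. a \<bullet> (L ^^ n) x / fact n"
  have eq: "a \<bullet> linear_flow L x t = (\<Sum>n. ?c x n * t ^ n)" for x t
    using sums_inner_linear_flow[OF assms] by (rule sums_unique)
  have "((\<lambda>t. \<Sum>n. ?c x n * t ^ n) has_real_derivative (\<Sum>n. diffs (?c x) n * t ^ n)) (at t)"
    by (rule termdiffs_strong_converges_everywhere)
      (rule sums_summable[OF sums_inner_linear_flow[OF assms]])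
  moreover have "diffs (?c x) = ?c (L x)"
    by (auto simp: diffs_def fun_eq_iff funpow_swap1 simp del: of_nat_Suc)
  ultimately show ?thesis
    by (simp add: eq flip: linear_flow_commute[OF assms])
qed

lemma linear_flow_has_vector_derivative:
  fixes L :: "'a::euclidean_space \<Rightarrow> 'a"
  assumes "linear L"
  shows "(linear_flow L x has_vector_derivative L (linear_flow L x t)) (at t)"
  unfolding has_vector_derivative_def
proof (subst has_derivative_componentwise_within, rule ballI)
  fix i :: 'a
  show "((\<lambda>t. linear_flow L x t \<bullet> i) has_derivative (\<lambda>s. (s *\<^sub>R L (linear_flow L x t)) \<bullet> i)) (at t)"
    using inner_linear_flow_has_derivative[OF assms, of i x t]
    by (simp add: has_field_derivative_def inner_commute mult.commute[of _ "_ \<bullet> _"])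
qed

lemma linear_flow_in_subspace:
  fixes L :: "'a::euclidean_space \<Rightarrow> 'a"
  assumes "linear L" "subspace V" "\<And>n. (L ^^ n) x \<in> V"
  shows "linear_flow L x t \<in> V"
proof (rule closed_sequentially[OF closed_subspace[OF \<open>subspace V\<close>]])
  show "(\<lambda>N. \<Sum>n<N. (t ^ n / fact n) *\<^sub>R (L ^^ n) x) \<longlonglongrightarrow> linear_flow L x t"
    using summable_sums[OF summable_linear_flow[OF assms(1), of t x]]
    by (simp add: sums_def linear_flow_def)
  show "(\<Sum>n<N. (t ^ n / fact n) *\<^sub>R (L ^^ n) x) \<in> V" for N
    using assms by (intro subspace_sum subspace_scale)
qed

text \<open>
  With \<open>g = linear_flow L' b\<close>, the derivative of \<open>s \<mapsto> g(t - s) \<bullet> u(s)\<close> is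
  \<open>- L' (g(t - s)) \<bullet> u(s) + g(t - s) \<bullet> L (u(s)) = 0\<close> by adjointness; compare \<open>s\<close> with \<open>t\<close>.
  The lemma expresses every observation of every solution through one fixed curve, and thereby
  replaces the uniqueness theorem for the differential equation.
\<close>

lemma dual_linear_flow:
  fixes L L' :: "'a::euclidean_space \<Rightarrow> 'a"
  assumes "linear L'" "\<And>x y. L' x \<bullet> y = x \<bullet> L y"
    and u: "\<And>t. (u has_vector_derivative L (u t)) (at t)"
  shows "b \<bullet> u t = linear_flow L' b (t - s) \<bullet> u s"
proof -
  let ?g = "linear_flow L' b"
  have g: "((\<lambda>s. ?g (t - s)) has_vector_derivative - L' (?g (t - s))) (at s)" for s
  proof -
    have "((\<lambda>s. t - s) has_vector_derivative - 1) (at s)"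
      by (auto intro!: derivative_eq_intros)
    from vector_diff_chain_at[OF this linear_flow_has_vector_derivative[OF assms(1)]]
    show ?thesis by (simp add: o_def)
  qed
  have "((\<lambda>s. ?g (t - s) \<bullet> u s) has_real_derivative 0) (at s)" for s
    using bounded_bilinear.has_vector_derivative[OF bounded_bilinear_inner g u, of s]
    by (simp add: has_real_derivative_iff_has_vector_derivative assms(2))
  then have "?g (t - t) \<bullet> u t = ?g (t - s) \<bullet> u s"
    by (intro DERIV_isconst_all[of "\<lambda>s. ?g (t - s) \<bullet> u s"]) simp
  then show ?thesis by (simp add: linear_flow_0)
qed

section \<open>Zeros of entire functions on the real line\<close>

text \<open>
  The series extends to an entire function \<open>F\<close>, whose zeros are countable unless it is constant. To
  treat constant \<open>F\<close> uniformly, the argument is applied to \<open>z F(z)\<close>, which vanishes at \<open>0\<close>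
  but, having a nonzero coefficient, nowhere else near \<open>0\<close>, and hence is never constant.
\<close>

lemma countable_zeros_real_power_series:
  fixes c :: "nat \<Rightarrow> real"
  assumes summable: "\<And>t. summable (\<lambda>n. c n * t ^ n)" and "c k \<noteq> 0"
  shows "countable {t. (\<Sum>n. c n * t ^ n) = 0}"
proof -
  \<comment> \<open>the coefficients of \<open>z F(z)\<close>\<close>
  define a :: "nat \<Rightarrow> complex" where "a n = (case n of 0 \<Rightarrow> 0 | Suc j \<Rightarrow> of_real (c j))" for n
  define F where "F z = (\<Sum>n. of_real (c n) * z ^ n)" for z :: complex
  have F: "(\<lambda>n. of_real (c n) * z ^ n) sums F z" for z
  proof -
    have "summable (\<lambda>n. norm (c n * norm z ^ n))"
      by (rule powser_insidea[OF summable[of "norm z + 1"]]) simp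
    then have "summable (\<lambda>n. norm (of_real (c n) * z ^ n))"
      by (simp add: norm_mult norm_power abs_mult)
    then have "summable (\<lambda>n. of_real (c n) * z ^ n)"
      by (rule summable_norm_cancel)
    then show ?thesis unfolding F_def by (rule summable_sums)
  qed
  have G: "(\<lambda>n. a n * z ^ n) sums (z * F z)" for z
  proof -
    have "(\<lambda>n. a (Suc n) * z ^ Suc n) sums (z * F z)"
      using sums_mult[OF F[of z], of z] by (simp add: a_def algebra_simps)
    then show ?thesis using sums_Suc_iff[of "\<lambda>n. a n * z ^ n" "z * F z"] by (simp add: a_def)
  qed
  have "((\<lambda>z. z * F z) has_field_derivative (\<Sum>n. diffs a n * z ^ n)) (at z)" for z
    using termdiffs_strong_converges_everywhere[OF sums_summable[OF G]] sums_unique[OF G]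
    by simp
  then have hol: "(\<lambda>z. z * F z) holomorphic_on UNIV"
    unfolding holomorphic_on_def field_differentiable_def by auto
  obtain s where "s > 0" and s: "\<And>z. z \<in> cball 0 s - {0} \<Longrightarrow> z * F z \<noteq> 0"
    using powser_0_nonzero[of 1 0 a "\<lambda>z. z * F z" "Suc k"] G assms(2)
    by (auto simp: a_def)
  have "\<not> (\<lambda>z. z * F z) constant_on UNIV"
  proof
    assume "(\<lambda>z. z * F z) constant_on UNIV"
    then have "of_real s * F (of_real s) = 0 * F 0"
      unfolding constant_on_def by (metis UNIV_I)
    then show False using s[of "of_real s"] \<open>s > 0\<close> by auto
  qed
  then have "countable {z \<in> UNIV. z * F z = 0}"
    using hol by (intro holomorphic_countable_zeros) auto
  moreover have "{t. (\<Sum>n. c n * t ^ n) = 0} \<subseteq> Re ` {z \<in> UNIV. z * F z = 0}"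
  proof safe
    fix t :: real
    assume t: "(\<Sum>n. c n * t ^ n) = 0"
    have "(\<lambda>n. complex_of_real (c n * t ^ n)) sums of_real (\<Sum>n. c n * t ^ n)"
      by (intro sums_of_real summable_sums summable)
    then have "F (of_real t) = 0"
      using F[of "of_real t"] t by (auto dest: sums_unique2)
    then show "t \<in> Re ` {z \<in> UNIV. z * F z = 0}"
      by (intro image_eqI[of _ _ "of_real t"]) auto
  qed
  ultimately show ?thesis
    by (meson countable_image countable_subset)
qed

lemma countable_linear_flow_hits_hyperplane:
  fixes L :: "'a::euclidean_space \<Rightarrow> 'a"
  assumes "linear L" "a \<bullet> (L ^^ k) x \<noteq> 0"
  shows "countable {t. a \<bullet> linear_flow L x t = 0}"
proof -
  note s = sums_inner_linear_flow[OF assms(1), of a x]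
  show ?thesis
    using countable_zeros_real_power_series[of "\<lambda>n. a \<bullet> (L ^^ n) x / fact n" k]
      sums_summable[OF s] sums_unique[OF s] assms(2) by simp
qed

section \<open>Measurability of linear independence\<close>

text \<open>
  Orthogonalisation without normalisation, for dependent sequences as well: a vanishing
  \<open>gram_schmidt v i\<close> contributes nothing to later positions, whatever the value of the quotient.
\<close>

fun gram_schmidt :: "(nat \<Rightarrow> 'a::euclidean_space) \<Rightarrow> nat \<Rightarrow> 'a" where
  "gram_schmidt v n = v n -
     (\<Sum>i\<in>{..<n}. ((gram_schmidt v i \<bullet> v n) / (gram_schmidt v i \<bullet> gram_schmidt v i))
        *\<^sub>R gram_schmidt v i)"

declare gram_schmidt.simps [simp del]

lemma gram_schmidt_orthogonal:
  "i < n \<Longrightarrow> gram_schmidt v i \<bullet> gram_schmidt v n = 0"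
proof (induction n arbitrary: i rule: less_induct)
  case (less n)
  let ?q = "gram_schmidt v"
  have orth: "?q i \<bullet> ?q j = 0" if "i < n" "j < n" "i \<noteq> j" for i j
    using less.IH[of i j] less.IH[of j i] that by (cases i j rule: linorder_cases) (auto simp: inner_commute)
  have "?q i \<bullet> ?q n = ?q i \<bullet> v n - (\<Sum>j<n. ((?q j \<bullet> v n) / (?q j \<bullet> ?q j)) * (?q i \<bullet> ?q j))"
    by (subst gram_schmidt.simps[of v n]) (simp add: inner_diff_right inner_sum_right)
  also have "(\<Sum>j<n. ((?q j \<bullet> v n) / (?q j \<bullet> ?q j)) * (?q i \<bullet> ?q j))
      = (\<Sum>j<n. if j = i then ?q i \<bullet> v n else 0)"
    using less.prems orth by (intro sum.cong) auto
  finally show ?case using less.prems by simp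
qed

lemma diff_gram_schmidt_in_span: "v n - gram_schmidt v n \<in> span (gram_schmidt v ` {..<n})"
proof -
  have "v n - gram_schmidt v n =
    (\<Sum>i<n. ((gram_schmidt v i \<bullet> v n) / (gram_schmidt v i \<bullet> gram_schmidt v i)) *\<^sub>R gram_schmidt v i)"
    by (subst gram_schmidt.simps[of v n]) simp
  then show ?thesis
    by (auto intro!: span_sum span_scale intro: span_base)
qed

lemma span_gram_schmidt: "span (gram_schmidt v ` {..<n}) = span (v ` {..<n})"
proof (induction n)
  case (Suc n)
  let ?q = "gram_schmidt v"
  have "span (insert (?q n) (?q ` {..<n})) = span (insert (v n) (?q ` {..<n}))"
    using span_neg[OF diff_gram_schmidt_in_span[of v n]] by (intro eq_span_insert_eq) simp
  also have "\<dots> = span (insert (v n) (v ` {..<n}))"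
    using Suc by (simp add: span_insert)
  finally show ?case by (simp add: lessThan_Suc)
qed simp

lemma gram_schmidt_eq_0_iff: "gram_schmidt v n = 0 \<longleftrightarrow> v n \<in> span (v ` {..<n})"
proof
  let ?q = "gram_schmidt v"
  have d: "v n - ?q n \<in> span (v ` {..<n})"
    using diff_gram_schmidt_in_span[of v n] by (simp add: span_gram_schmidt)
  show "v n \<in> span (v ` {..<n})" if "?q n = 0" using d that by simp
  assume "v n \<in> span (v ` {..<n})"
  \<comment> \<open>then \<open>?q n\<close> lies in the span of vectors orthogonal to it\<close>
  then have "?q n \<in> span (?q ` {..<n})"
    using span_diff[OF _ d] by (fastforce simp: span_gram_schmidt)
  then have "orthogonal (?q n) (?q n)"
    by (rule orthogonal_to_span) (auto simp: orthogonal_def inner_commute gram_schmidt_orthogonal)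
  then show "?q n = 0" by (simp add: orthogonal_def)
qed

text \<open>
  The recursion uses only inner products, division and scaling, all of which are Borel measurable. Together
  with \<open>gram_schmidt_eq_0_iff\<close> this makes membership in the span of the previous vectors a
  measurable condition, which is not evident from the existential definition of the span.
\<close>

lemma measurable_gram_schmidt [measurable (raw)]:
  assumes "\<And>i. i \<le> n \<Longrightarrow> (\<lambda>x. v x i) \<in> borel_measurable M"
  shows "(\<lambda>x. gram_schmidt (v x) n) \<in> borel_measurable M"
  using assms
proof (induction n rule: less_induct)
  case (less n)
  have [measurable]: "(\<lambda>x. gram_schmidt (v x) i) \<in> borel_measurable M" if "i \<in> {..<n}" for i
    using that less by auto
  have [measurable]: "(\<lambda>x. v x n) \<in> borel_measurable M" using less.prems by simp
  show ?case by (subst gram_schmidt.simps) measurable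
qed

lemma independent_if_notin_span_previous:
  fixes v :: "nat \<Rightarrow> 'a::real_vector"
  assumes "\<And>i. i < n \<Longrightarrow> v i \<notin> span (v ` {..<i})"
  shows "independent (v ` {..<n}) \<and> inj_on v {..<n}"
  using assms
proof (induction n)
  case (Suc n)
  then have "independent (v ` {..<n})" "inj_on v {..<n}" "v n \<notin> span (v ` {..<n})" by auto
  then show ?case
    by (auto simp: lessThan_Suc independent_insert intro: span_base)
qed (simp add: independent_empty)

section \<open>Almost every sample of a curve is linearly independent\<close>

text \<open>
  Induction on the number of samples. Once the first \<open>k\<close> samples are independent, the
  next parameter is bad only if \<open>g\<close> hits their span, which has dimension at most \<open>k < m\<close>; so
  almost every section of the bad set is null, and so is the bad set by Fubini. The shift by \<open>Suc\<close>
  matches coordinates \<open>1, \<dots>, k\<close> with sequences that start at \<open>0\<close>.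
\<close>

lemma AE_samples_independent:
  fixes g :: "real \<Rightarrow> 'a::euclidean_space"
  assumes [measurable]: "g \<in> borel_measurable borel"
    and null: "\<And>W. subspace W \<Longrightarrow> dim W < m \<Longrightarrow> {s. g s \<in> W} \<in> null_sets lborel"
    and "k \<le> m"
  shows "AE \<tau> in Pi\<^sub>M {1..k} (\<lambda>_. lborel).
           \<forall>i<k. g (\<tau> (Suc i)) \<notin> span ((\<lambda>i. g (\<tau> (Suc i))) ` {..<i})"
  using \<open>k \<le> m\<close>
proof (induction k)
  case (Suc k)
  interpret product_sigma_finite "\<lambda>_::nat. lborel :: real measure" by standard
  let ?v = "\<lambda>\<tau> i. g (\<tau> (Suc i))"
  define P where "P k \<tau> \<longleftrightarrow> (\<forall>i<k. ?v \<tau> i \<notin> span (?v \<tau> ` {..<i}))" for k \<tau>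
  let ?M = "\<lambda>k. Pi\<^sub>M {1..k} (\<lambda>_. lborel :: real measure)"
  have eq: "{1..Suc k} = insert (Suc k) {1..k}" by auto
  have meas: "{\<tau> \<in> space (?M (Suc k)). \<not> P (Suc k) \<tau>} \<in> sets (?M (Suc k))" (is "?N \<in> _")
  proof -
    have "(\<lambda>\<tau>. ?v \<tau> i) \<in> borel_measurable (?M (Suc k))" if "i \<le> k" for i
      using that by (intro measurable_compose[OF _ assms(1)] measurable_compose[OF measurable_component_singleton]) auto
    then have [measurable]: "(\<lambda>\<tau>. gram_schmidt (?v \<tau>) i) \<in> borel_measurable (?M (Suc k))" if "i \<in> {..k}" for i
      using that by (intro measurable_gram_schmidt) auto
    have "P (Suc k) \<tau> \<longleftrightarrow> (\<forall>i\<in>{..k}. gram_schmidt (?v \<tau>) i \<noteq> 0)" for \<tau>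
      unfolding P_def gram_schmidt_eq_0_iff by auto
    then show ?thesis by simp
  qed
  \<comment> \<open>the sections of the bad set in the last coordinate\<close>
  have upd: "P (Suc k) (\<tau>(Suc k := s)) \<longleftrightarrow> P k \<tau> \<and> g s \<notin> span (?v \<tau> ` {..<k})" for \<tau> s
  proof -
    have "?v (\<tau>(Suc k := s)) ` {..<i} = ?v \<tau> ` {..<i}" if "i \<le> k" for i
      using that by (intro image_cong) auto
    then show ?thesis by (auto simp: P_def less_Suc_eq)
  qed
  have "emeasure (?M (Suc k)) ?N = (\<integral>\<^sup>+\<tau>. indicator ?N \<tau> \<partial>?M (Suc k))"
    using meas by simp
  also have "\<dots> = (\<integral>\<^sup>+\<tau>. (\<integral>\<^sup>+s. indicator ?N (\<tau>(Suc k := s)) \<partial>lborel) \<partial>?M k)"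
    using meas unfolding eq by (intro product_nn_integral_insert) auto
  also have "\<dots> = (\<integral>\<^sup>+\<tau>. 0 \<partial>?M k)"
  proof (rule nn_integral_cong_AE)
    have "AE \<tau> in ?M k. P k \<tau>"
      using Suc unfolding P_def by simp
    then show "AE \<tau> in ?M k. (\<integral>\<^sup>+s. indicator ?N (\<tau>(Suc k := s)) \<partial>lborel) = 0"
    proof (rule AE_mp, intro AE_I2 impI)
      fix \<tau> assume "P k \<tau>"
      let ?W = "span (?v \<tau> ` {..<k})"
      have "dim ?W \<le> card (?v \<tau> ` {..<k})"
        by (simp add: dim_le_card')
      also have "\<dots> \<le> k" using card_image_le[of "{..<k}" "?v \<tau>"] by simp
      finally have "{s. g s \<in> ?W} \<in> null_sets lborel"
        using Suc.prems by (intro null) auto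
      then have "AE s in lborel. s \<notin> {s. g s \<in> ?W}" by (rule AE_not_in)
      then have "AE s in lborel. (indicator ?N (\<tau>(Suc k := s)) :: ennreal) = 0"
        by eventually_elim (simp add: upd \<open>P k \<tau>\<close>)
      then show "(\<integral>\<^sup>+s. indicator ?N (\<tau>(Suc k := s)) \<partial>lborel) = 0"
        by (subst nn_integral_cong_AE) auto
    qed
  qed
  finally have "AE \<tau> in ?M (Suc k). P (Suc k) \<tau>"
    using meas by (subst AE_iff_measurable[OF meas]) auto
  then show ?case by (simp add: P_def)
qed simp

section \<open>Krylov spaces at the stabilization index\<close>

lemma stabilization_index_works:
  assumes "b \<noteq> 0"
  shows "is_stabilization_index A b (stabilization_index A b)"
  unfolding stabilization_index_def by (rule theI'[OF ex1_stabilization_index[OF assms]])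

text \<open>
  The Krylov spaces stop growing at the stabilization index, so the whole orbit of \<open>b\<close> lies in the
  last one.
\<close>

lemma funpow_in_krylov_space_stabilization_index:
  assumes "b \<noteq> 0"
  shows "(((*v) (transpose A)) ^^ k) b \<in> krylov_space A b (stabilization_index A b)"
proof -
  let ?r = "stabilization_index A b"
  have "krylov_space A b (max k ?r) = krylov_space A b ?r"
    using stabilization_index_works[OF assms, of A]
    by (intro krylov_space_stable) (auto simp: is_stabilization_index_def)
  moreover have "(((*v) (transpose A)) ^^ k) b \<in> krylov_space A b (max k ?r)"
    unfolding krylov_space_def by (intro span_base) auto
  ultimately show ?thesis by simp
qed

text \<open>
  Each step before the stabilization index raises the dimension: had the chain paused earlier,
  \<open>krylov_space_stable\<close> would make it constant from there on, against the strict growth in the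
  last step.
\<close>

lemma dim_krylov_space_stabilization_index:
  assumes "b \<noteq> 0"
  shows "dim (krylov_space A b (stabilization_index A b)) = stabilization_index A b + 1"
proof (rule antisym)
  let ?r = "stabilization_index A b"
  let ?d = "\<lambda>k. dim (krylov_space A b k)"
  have "?d ?r \<le> card ((\<lambda>j. (((*v) (transpose A)) ^^ j) b) ` {..?r})"
    unfolding krylov_space_def dim_span by (rule dim_le_card') simp
  also have "\<dots> \<le> ?r + 1" using card_image_le[of "{..?r}"] by fastforce
  finally show "?d ?r \<le> ?r + 1" .
  have "k + 1 \<le> ?d k" if "k \<le> ?r" for k
    using that
  proof (induction k)
    case 0
    then show ?case using dim_krylov_space_0[OF assms, of A] by simp
  next
    case (Suc k)
    have "?d k \<noteq> ?d (Suc k)"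
    proof
      assume eq: "?d k = ?d (Suc k)"
      have "krylov_space A b ?r = krylov_space A b k"
        "krylov_space A b (?r - 1) = krylov_space A b k"
        using Suc.prems by (auto intro!: krylov_space_stable[OF eq])
      then show False
        using stabilization_index_works[OF assms, of A] Suc.prems
        by (auto simp: is_stabilization_index_def split: if_splits)
    qed
    moreover have "?d k \<le> ?d (Suc k)"
      by (intro dim_subset krylov_space_mono) simp
    ultimately show ?case using Suc by simp
  qed
  then show "?r + 1 \<le> ?d ?r" by simp
qed

text \<open>
  Since \<open>W\<close> does not contain the stable Krylov space \<open>V\<close>, some nonzero \<open>a\<close> in \<open>V\<close> is orthogonal to
  \<open>W \<inter> V\<close>. The curve stays in \<open>V\<close>, so it meets \<open>W\<close> only where it meets the hyperplane orthogonal to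
  \<open>a\<close>; and it is not contained in that hyperplane, because otherwise \<open>a\<close> would be orthogonal to the
  generators of \<open>V\<close> and thus to itself.
\<close>

lemma countable_observability_curve_in_subspace:
  fixes A :: "real^'n^'n"
  assumes "b \<noteq> 0" "subspace W" "dim W < stabilization_index A b + 1"
  shows "countable {t. linear_flow ((*v) (transpose A)) b t \<in> W}"
proof -
  let ?L = "(*v) (transpose A)"
  let ?r = "stabilization_index A b"
  let ?V = "krylov_space A b ?r"
  have V: "span ?V = ?V" by (simp add: krylov_space_def span_span)
  have lin: "linear ?L" by (rule matrix_vector_mul_linear)
  have "span (W \<inter> ?V) \<subset> span ?V"
  proof -
    have "dim (W \<inter> ?V) < dim ?V"
      using dim_subset[of "W \<inter> ?V" W] assms(3)
      unfolding dim_krylov_space_stabilization_index[OF assms(1)] by simp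
    then have "span (W \<inter> ?V) \<noteq> span ?V" using span_eq_dim[of "W \<inter> ?V" ?V] by linarith
    then show ?thesis using span_mono[of "W \<inter> ?V" ?V] by auto
  qed
  from orthogonal_to_subspace_exists_gen[OF this]
  obtain a where a: "a \<noteq> 0" "a \<in> ?V" and orth: "\<And>y. y \<in> span (W \<inter> ?V) \<Longrightarrow> orthogonal a y"
    unfolding V by blast
  have "\<exists>k. a \<bullet> (?L ^^ k) b \<noteq> 0"
  proof (rule ccontr)
    assume "\<not> ?thesis"
    then have "orthogonal a a"
      using a(2) unfolding krylov_space_def
      by (intro orthogonal_to_span[of a]) (auto simp: orthogonal_def)
    then show False using a(1) by (simp add: orthogonal_def)
  qed
  then have "countable {t. a \<bullet> linear_flow ?L b t = 0}"
    using countable_linear_flow_hits_hyperplane[OF lin] by blast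
  moreover have "linear_flow ?L b t \<in> ?V" for t
    using funpow_in_krylov_space_stabilization_index[OF assms(1)]
    by (intro linear_flow_in_subspace lin) (simp_all add: krylov_space_def)
  then have "{t. linear_flow ?L b t \<in> W} \<subseteq> {t. a \<bullet> linear_flow ?L b t = 0}"
    using orth by (auto simp: orthogonal_def intro: span_base)
  ultimately show ?thesis by (rule countable_subset[rotated])
qed

section \<open>From bases of the Krylov space to delay equations\<close>

text \<open>
  With \<open>g\<close> the flow of \<open>b\<close> under the transpose of \<open>A\<close>, \<open>dual_linear_flow\<close> turns the right-hand side of
  the delay equation into \<open>(\<Sum>k\<in>I. w k *\<^sub>R g (- \<tau> k)) \<bullet> u t\<close>, while the derivative of \<open>y\<close> is
  \<open>(transpose A *v b) \<bullet> u t\<close>. The two agree for all solutions \<open>u\<close> only if the vectors agree,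
  since solutions have arbitrary initial values.
\<close>

lemma delay_equation_iff:
  fixes A :: "real^'n^'n" and w \<tau> :: "'i \<Rightarrow> real"
  shows "(\<forall>y. observable_trajectory A b y \<longrightarrow>
            (\<forall>t. (y has_real_derivative (\<Sum>k\<in>I. w k * y (t - \<tau> k))) (at t))) \<longleftrightarrow>
         (\<Sum>k\<in>I. w k *\<^sub>R linear_flow ((*v) (transpose A)) b (- \<tau> k)) = transpose A *v b"
    (is "?delay \<longleftrightarrow> ?S = _")
proof -
  let ?g = "linear_flow ((*v) (transpose A)) b"
  have dual: "(transpose A *v x) \<bullet> y = x \<bullet> (A *v y)" for x y :: "real^'n"
    by (simp add: dot_lmul_matrix)
  have shift: "b \<bullet> u (t + s) = ?g s \<bullet> u t"
    if "\<And>t. (u has_vector_derivative A *v u t) (at t)" for u s t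
    using dual_linear_flow[of "(*v) (transpose A)" "(*v) A", OF _ dual that, of b "t + s" t]
    by (simp del: transpose_matrix_vector)
  have sum: "(\<Sum>k\<in>I. w k * (b \<bullet> u (t - \<tau> k))) = ?S \<bullet> u t"
    if "\<And>t. (u has_vector_derivative A *v u t) (at t)" for u t
    using shift[OF that, of t "- \<tau> _"] by (simp add: inner_sum_left)
  have deriv: "((\<lambda>t. b \<bullet> u t) has_real_derivative (transpose A *v b) \<bullet> u t) (at t)"
    if "\<And>t. (u has_vector_derivative A *v u t) (at t)" for u t
    using bounded_linear.has_vector_derivative[OF bounded_linear_inner_right that, of b t]
    unfolding dual by (simp add: has_real_derivative_iff_has_vector_derivative)
  show ?thesis
  proof
    assume eq: "?S = transpose A *v b"
    show ?delay
    proof (intro allI impI)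
      fix y t assume "observable_trajectory A b y"
      then obtain u where u: "\<And>t. (u has_vector_derivative A *v u t) (at t)"
        and y: "y = (\<lambda>t. b \<bullet> u t)"
        unfolding observable_trajectory_def by blast
      show "(y has_real_derivative (\<Sum>k\<in>I. w k * y (t - \<tau> k))) (at t)"
        unfolding y sum[OF u] eq by (rule deriv[OF u])
    qed
  next
    assume delay: ?delay
    have "?S \<bullet> x = (transpose A *v b) \<bullet> x" for x
    proof -
      define u where "u = linear_flow ((*v) A) x"
      have u: "(u has_vector_derivative A *v u t) (at t)" for t
        unfolding u_def by (intro linear_flow_has_vector_derivative) simp
      then have "observable_trajectory A b (\<lambda>t. b \<bullet> u t)"
        unfolding observable_trajectory_def by blast
      with delay have "((\<lambda>t. b \<bullet> u t) has_real_derivative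
          (\<Sum>k\<in>I. w k * (b \<bullet> u (0 - \<tau> k)))) (at 0)"
        by blast
      then have "((\<lambda>t. b \<bullet> u t) has_real_derivative ?S \<bullet> u 0) (at 0)"
        unfolding sum[OF u] .
      then have "?S \<bullet> u 0 = (transpose A *v b) \<bullet> u 0"
        by (rule DERIV_unique[OF _ deriv[OF u]])
      then show ?thesis by (simp add: u_def linear_flow_0)
    qed
    then show "?S = transpose A *v b" using vector_eq_rdot by blast
  qed
qed

text \<open>
  Extensionality fixes the values of \<open>w\<close> outside \<open>I\<close>, without which the coefficients could
  not be unique as a function on the whole type.
\<close>

lemma ex1_coefficients:
  fixes v :: "'i \<Rightarrow> 'a::real_vector"
  assumes "finite I" "independent (v ` I)" "inj_on v I" "x \<in> span (v ` I)"
  shows "\<exists>!w. w \<in> extensional I \<and> (\<Sum>k\<in>I. w k *\<^sub>R v k) = x"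
proof (rule ex_ex1I)
  obtain c where "x = (\<Sum>z\<in>v ` I. c z *\<^sub>R z)"
    using assms(1,4) by (auto simp: span_finite)
  then have "x = (\<Sum>k\<in>I. c (v k) *\<^sub>R v k)"
    using assms(3) by (simp add: sum.reindex)
  then show "\<exists>w. w \<in> extensional I \<and> (\<Sum>k\<in>I. w k *\<^sub>R v k) = x"
    by (intro exI[of _ "restrict (c \<circ> v) I"]) simp
next
  fix w w'
  assume w: "w \<in> extensional I \<and> (\<Sum>k\<in>I. w k *\<^sub>R v k) = x"
    and w': "w' \<in> extensional I \<and> (\<Sum>k\<in>I. w' k *\<^sub>R v k) = x"
  let ?c = "\<lambda>z. w (the_inv_into I v z) - w' (the_inv_into I v z)"
  have "(\<Sum>z\<in>v ` I. ?c z *\<^sub>R z) = (\<Sum>k\<in>I. (w k - w' k) *\<^sub>R v k)"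
    using assms(3) by (simp add: sum.reindex the_inv_into_f_f)
  also have "\<dots> = 0" using w w' by (simp add: algebra_simps sum_subtractf)
  finally have "?c (v k) = 0" if "k \<in> I" for k
    using independentD[OF assms(2), of "v ` I" ?c "v k"] assms(1) that by blast
  then have "w k = w' k" if "k \<in> I" for k
    using assms(3) that by (simp add: the_inv_into_f_f)
  then show "w = w'" using w w' by (auto intro: extensionalityI)
qed

theorem theorem3p6:
  fixes A :: "real^'n^'n" and b :: "real^'n" and r :: nat
  assumes "rank A = CARD('n)"
    and "b \<noteq> 0"
    and "r = stabilization_index A b"
  shows "AE \<tau> in delay_measure (r + 1). \<tau> \<in> ordered_delays (r + 1) \<longrightarrow>
           (\<exists>!w. w \<in> extensional {1..r + 1} \<and>
              (\<forall>y. observable_trajectory A b y \<longrightarrow>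
                (\<forall>t. (y has_real_derivative (\<Sum>k = 1..r + 1. w k * y (t - \<tau> k))) (at t))))"
proof -
  let ?L = "(*v) (transpose A)"
  let ?V = "krylov_space A b r"
  define g where "g s = linear_flow ?L b (- s)" for s
  have lin: "linear ?L" by (rule matrix_vector_mul_linear)
  have powV: "(?L ^^ k) b \<in> ?V" for k
    unfolding assms(3) by (rule funpow_in_krylov_space_stabilization_index[OF assms(2)])
  have subV: "subspace ?V" by (simp add: krylov_space_def)
  have gV: "g s \<in> ?V" for s
    unfolding g_def by (rule linear_flow_in_subspace[OF lin subV powV])
  have "continuous_on UNIV (linear_flow ?L b)"
    by (intro continuous_at_imp_continuous_on ballI
        has_vector_derivative_continuous[OF linear_flow_has_vector_derivative[OF lin]])
  then have "continuous_on UNIV g"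
    unfolding g_def
    by (rule continuous_on_compose2[OF _ continuous_on_minus[OF continuous_on_id]]) simp
  then have meas: "g \<in> borel_measurable borel"
    by (rule borel_measurable_continuous_onI)
  have null: "{s. g s \<in> W} \<in> null_sets lborel" if "subspace W" "dim W < r + 1" for W
  proof -
    have "countable {t. linear_flow ?L b t \<in> W}"
      using countable_observability_curve_in_subspace[OF assms(2), of W A] that
      unfolding assms(3) by blast
    moreover have "{s. g s \<in> W} = uminus ` {t. linear_flow ?L b t \<in> W}"
      unfolding g_def by (force simp: image_iff)
    ultimately show ?thesis by (simp add: countable_imp_null_set_lborel)
  qed
  have "AE \<tau> in delay_measure (r + 1).
      \<forall>i<r + 1. g (\<tau> (Suc i)) \<notin> span ((\<lambda>i. g (\<tau> (Suc i))) ` {..<i})"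
    by (rule AE_samples_independent[OF meas null order.refl])
  then show ?thesis
  proof eventually_elim
    case (elim \<tau>)
    let ?v = "\<lambda>k. g (\<tau> k)"
    have I: "{1..r + 1} = Suc ` {..<r + 1}"
      by (simp add: image_Suc_lessThan)
    have "independent ((\<lambda>i. ?v (Suc i)) ` {..<r + 1}) \<and> inj_on (\<lambda>i. ?v (Suc i)) {..<r + 1}"
      using elim by (intro independent_if_notin_span_previous) blast
    then have ind: "independent (?v ` {1..r + 1})" and inj: "inj_on ?v {1..r + 1}"
      unfolding I by (auto simp: image_image inj_on_def)
    \<comment> \<open>as many independent vectors in \<open>?V\<close> as its dimension span it\<close>
    have "?V \<subseteq> span (?v ` {1..r + 1})"
      using ind gV card_image[OF inj] dim_krylov_space_stabilization_index[OF assms(2), of A]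
      by (intro card_ge_dim_independent) (auto simp: assms(3))
    then have "transpose A *v b \<in> span (?v ` {1..r + 1})"
      using powV[of 1] by auto
    from ex1_coefficients[OF finite_atLeastAtMost ind inj this]
    have "\<exists>!w. w \<in> extensional {1..r + 1} \<and>
        (\<Sum>k = 1..r + 1. w k *\<^sub>R linear_flow ?L b (- \<tau> k)) = transpose A *v b"
      unfolding g_def .
    then show ?case
      unfolding delay_equation_iff by (rule impI)
  qed
qed

end
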